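(* Let $D$ be a strong digraph of order $n\ge 2$. Then $\rho(D)-\pi(D)\le \frac{n}{2}-1$. The upper bound holds with equality if and only if $D$ contains a Hamiltonian dipath $v_1v_2\dots v_n$ such that $\{v_iv_j\mid 2\le i+1<j\le n\}\subseteq A(\overline{D})$ and at least one of the vertices $v_{n-1},v_n$ has out-degree $n-1$.
   Context: All digraphs are finite, without loops or parallel arcs (opposite arcs $uv$ and $vu$ may both be present). $V(D)$ and $A(D)$ are the vertex set and the arc set of $D$. A digraph $D$ is strong if for every pair $u,v$ of vertices there are a directed path from $u$ to $v$ and a directed path from $v$ to $u$. A dipath is a directed path. For a strong digraph $D$ of order $n\ge 2$, $d(u,v)$ is the length of a shortest dipath from $u$ to $v$; $\sigma(u)=\sum_{v\in V(D)}d(u,v)$; $\bar\sigma(u)=\frac{\sigma(u)}{n-1}$; the proximity is $\pi(D)=\min\{\bar\sigma(u)\mid u\in V(D)\}$ and the remoteness is $\rho(D)=\max\{\bar\sigma(u)\mid u\in V(D)\}$. The complement $\overline{D}$ has $V(\overline{D})=V(D)$ and $A(\overline{D})=\{uv\mid u\ne v\in V(D),\ uv\notin A(D)\}$. *)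

theory Defs
  imports "Graph_Theory.Graph_Theory"
begin

text \<open>
  The arc set \<open>A(D)\<close>, as a set of pairs of vertices, is \<open>arcs_ends D\<close>; the absence of loops and
  parallel arcs is part of the locale \<open>digraph\<close>.
\<close>

text \<open>
  The value is meaningful only if there is a dipath from \<open>u\<close> to \<open>v\<close>, which is always the case for
  vertices of a strong digraph. For those it agrees with \<open>\<mu>\<close> for unit arc weights, see
  \<open>real_path_dist_eq_mu\<close> below.
\<close>
definition path_dist :: "('a, 'b) pre_digraph \<Rightarrow> 'a \<Rightarrow> 'a \<Rightarrow> nat" where
  "path_dist D u v = (LEAST k. \<exists>p. vpath p D \<and> hd p = u \<and> last p = v \<and> vwalk_length p = k)"

definition total_dist :: "('a, 'b) pre_digraph \<Rightarrow> 'a \<Rightarrow> nat" where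
  "total_dist D u = (\<Sum>v\<in>verts D. path_dist D u v)"

definition average_dist :: "('a, 'b) pre_digraph \<Rightarrow> 'a \<Rightarrow> real" where
  "average_dist D u = real (total_dist D u) / (real (card (verts D)) - 1)"

definition proximity :: "('a, 'b) pre_digraph \<Rightarrow> real" where
  "proximity D = Min {average_dist D u | u. u \<in> verts D}"

definition remoteness :: "('a, 'b) pre_digraph \<Rightarrow> real" where
  "remoteness D = Max {average_dist D u | u. u \<in> verts D}"

definition complement_digraph :: "('a, 'b) pre_digraph \<Rightarrow> 'a pair_pre_digraph" where
  "complement_digraph D =
    \<lparr>pverts = verts D,
     parcs = {(u, v) | u v. u \<in> verts D \<and> v \<in> verts D \<and> u \<noteq> v \<and> (u, v) \<notin> arcs_ends D}\<rparr>"

definition hamiltonian_dipath :: "'a list \<Rightarrow> ('a, 'b) pre_digraph \<Rightarrow> bool" where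
  "hamiltonian_dipath p D \<longleftrightarrow> vpath p D \<and> set p = verts D"

lemma length_vwalk_to_vpath_le: "length (vwalk_to_vpath p) \<le> length p"
proof (induct p rule: vwalk_to_vpath.induct)
  case (2 x xs)
  then show ?case
    using length_dropWhile_le[of "\<lambda>y. y \<noteq> x" xs] le_trans
    by (cases "x \<in> set xs") fastforce+
qed simp

lemma (in wf_digraph) vwalk_imp_awalk_ex:
  assumes "vwalk p G"
  shows "\<exists>q. awalk (hd p) q (last p) \<and> length q = vwalk_length p"
  using assms
proof (induct p rule: vwalk_arcs.induct)
  case 1
  then show ?case by (simp add: vwalk_def)
next
  case (2 x)
  then have "awalk x [] x" by (simp add: vwalk_def awalk_Nil_iff)
  then show ?case by (intro exI[of _ "[]"]) simp
next
  case (3 x y xs)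
  then have "vwalk (y # xs) G" and e: "(x, y) \<in> arcs_ends G" by (auto simp: vwalk_def)
  with 3 obtain q where q: "awalk y q (last (y # xs))" "length q = length xs" by auto
  from e obtain a where "a \<in> arcs G" "tail G a = x" "head G a = y" by (rule reachableE)
  with q have "awalk x (a # q) (last (y # xs))" by (simp add: awalk_Cons_iff)
  with q(2) show ?case by (intro exI[of _ "a # q"]) simp
qed

lemma (in wf_digraph) real_path_dist_eq_mu:
  assumes "u \<rightarrow>\<^sup>* v"
  shows "ereal (real (path_dist G u v)) = \<mu> (\<lambda>_. 1) u v"
proof -
  let ?P = "\<lambda>k. \<exists>p. vpath p G \<and> hd p = u \<and> last p = v \<and> vwalk_length p = k"
  have cost: "awalk_cost (\<lambda>_. 1) p = real (length p)" for p :: "'b list"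
    by (induct p) simp_all
  have short: "\<exists>k \<le> length p. ?P k" if "awalk u p v" for p
  proof -
    let ?w = "awalk_verts u p"
    have w: "vwalk ?w G" "hd ?w = u" "last ?w = v"
      using awalk_imp_vwalk[OF that] awends_of_awalk(1)[OF that] that by simp_all
    have "?P (vwalk_length (vwalk_to_vpath ?w))"
      using vwalk_to_vpath_vpath[OF w(1)] w(2,3)
      by (intro exI[of _ "vwalk_to_vpath ?w"])
        (simp del: vwalk_to_vpath.simps add: vwalk_to_vpath_hd vwalk_to_vpath_last)
    moreover have "vwalk_length (vwalk_to_vpath ?w) \<le> length p"
      using length_vwalk_to_vpath_le[of ?w]
      by (simp add: length_awalk_verts del: vwalk_to_vpath.simps)
    ultimately show ?thesis by blast
  qed
  obtain p0 where "awalk u p0 v" using assms by (auto simp: reachable_awalk)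
  then obtain k0 where "?P k0" using short by blast
  then have "?P (path_dist G u v)" unfolding path_dist_def by (rule LeastI)
  then obtain p1 where p1: "vwalk p1 G" "hd p1 = u" "last p1 = v"
    "vwalk_length p1 = path_dist G u v"
    by (elim exE conjE vpathE)
  obtain q where q: "awalk u q v" "length q = path_dist G u v"
    using vwalk_imp_awalk_ex[OF p1(1)] unfolding p1(2-4) by (elim exE conjE)
  have le: "path_dist G u v \<le> length p" if p: "awalk u p v" for p
  proof -
    obtain k where k: "k \<le> length p \<and> ?P k" using short[OF p] by (rule exE)
    have "path_dist G u v \<le> k" unfolding path_dist_def by (rule Least_le[of ?P, OF conjunct2[OF k]])
    also have "\<dots> \<le> length p" by (rule conjunct1[OF k])
    finally show ?thesis .
  qed
  show ?thesis
    unfolding \<mu>_def cost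
    by (rule INF_eqI[symmetric]) (use q(1) le in \<open>auto simp flip: q(2)\<close>)
qed

lemma (in fin_digraph) pair_digraph_complement: "pair_digraph (complement_digraph G)"
  by unfold_locales
    (auto simp: complement_digraph_def intro: finite_subset[of _ "verts G \<times> verts G"])

end

theory Submission
  imports Defs
begin

text \<open>
  The two extremes are bounded separately. The distances from a vertex \<open>u\<close> form a function without
  gaps: a vertex at distance \<open>k + 1\<close> has an in-neighbour at distance \<open>k\<close>. Hence the total distance
  from \<open>u\<close> is largest when every distance \<open>0, \<dots>, n - 1\<close> occurs exactly once
  (\<open>gapfree_sum_le\<close>, \<open>gapfree_sum_eq\<close>), so that \<open>\<rho> \<le> n / 2\<close>. On the other side all distances to
  other vertices are at least \<open>1\<close>, so \<open>\<pi> \<ge> 1\<close>. The difference is therefore at most \<open>n / 2 - 1\<close>, and it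
  is attained iff some vertex \<open>u\<close> has average distance \<open>n / 2\<close> and some vertex \<open>w\<close> has average
  distance \<open>1\<close>.

  The vertex \<open>u\<close> exists iff the vertices can be listed by their distance from \<open>u\<close>, which is a
  Hamiltonian dipath that no arc shortcuts (\<open>hamiltonian_dipath_of_extremal\<close>,
  \<open>total_dist_of_no_shortcut\<close>). The vertex \<open>w\<close> exists iff some vertex dominates all the others
  (\<open>total_dist_eq_iff\<close>). Only the last two vertices of a dipath without shortcuts can do that, because
  an arc from an earlier vertex to the last vertex would be a shortcut.
\<close>

section \<open>Natural-valued functions without gaps\<close>

text \<open>
  In this section \<open>f\<close> stands for the distance from a fixed vertex. The recurring hypothesis says that a
  point with a positive value has a point just below it, so that one can descend to \<open>0\<close> in unit steps.
\<close>
lemma gapfree_atMost_subset: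
  fixes f :: "'a \<Rightarrow> nat"
  assumes "\<And>x. x \<in> V \<Longrightarrow> f x > 0 \<Longrightarrow> \<exists>y\<in>V. f x = Suc (f y)" and "x \<in> V"
  shows "{..f x} \<subseteq> f ` V"
  using assms(2)
proof (induction "f x" arbitrary: x)
  case 0
  then show ?case by auto
next
  case (Suc k)
  then obtain y where y: "y \<in> V" "f x = Suc (f y)" using assms(1)[of x] by auto
  with Suc have "{..f y} \<subseteq> f ` V" by auto
  moreover have "f x \<in> f ` V" using Suc.prems by simp
  ultimately show ?case unfolding y(2) by (simp add: atMost_Suc)
qed

lemma gapfree_less_card:
  fixes f :: "'a \<Rightarrow> nat"
  assumes "finite V" and "\<And>x. x \<in> V \<Longrightarrow> f x > 0 \<Longrightarrow> \<exists>y\<in>V. f x = Suc (f y)" and "x \<in> V"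
  shows "f x < card V"
proof -
  have "card {..f x} \<le> card V"
    using gapfree_atMost_subset[of V f, OF assms(2,3)] assms(1) surj_card_le by blast
  then show ?thesis by simp
qed

lemma finite_attains_max:
  fixes f :: "'a \<Rightarrow> 'b :: linorder"
  assumes "finite V" and "V \<noteq> {}"
  shows "\<exists>m\<in>V. \<forall>y\<in>V. f y \<le> f m"
proof -
  from assms have "Max (f ` V) \<in> f ` V" by simp
  then obtain m where "m \<in> V" "f m = Max (f ` V)" by auto
  then show ?thesis using assms(1) by (metis Max_ge finite_imageI imageI)
qed

text \<open>
  The point just below \<open>y\<close> survives, because its value is smaller than the largest one. This allows
  induction on the number of points.
\<close>
lemma gapfree_delete_max:
  fixes f :: "'a \<Rightarrow> nat"
  assumes "\<And>x. x \<in> V \<Longrightarrow> f x > 0 \<Longrightarrow> \<exists>y\<in>V. f x = Suc (f y)"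
    and "\<And>y. y \<in> V \<Longrightarrow> f y \<le> f m" and "y \<in> V - {m}" and "f y > 0"
  shows "\<exists>z\<in>V - {m}. f y = Suc (f z)"
proof -
  obtain z where "z \<in> V" "f y = Suc (f z)" using assms(1)[of y] assms(3,4) by auto
  moreover have "f y \<le> f m" using assms(2)[of y] assms(3) by auto
  ultimately show ?thesis by auto
qed

text \<open>
  The largest value is at most \<open>card V - 1\<close>, because all smaller values occur as well. Deleting a
  point where it is attained therefore lowers the sum by at most the difference between the bounds
  for \<open>card V\<close> and for \<open>card V - 1\<close> points.
\<close>
lemma gapfree_sum_le:
  fixes f :: "'a \<Rightarrow> nat"
  assumes "finite V" and "\<And>x. x \<in> V \<Longrightarrow> f x > 0 \<Longrightarrow> \<exists>y\<in>V. f x = Suc (f y)"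
  shows "2 * sum f V \<le> card V * (card V - 1)"
  using assms
proof (induction "card V" arbitrary: V)
  case 0
  then show ?case by simp
next
  case (Suc k)
  then have "V \<noteq> {}" by auto
  with Suc.prems(1) obtain m where m: "m \<in> V" "\<And>y. y \<in> V \<Longrightarrow> f y \<le> f m"
    using finite_attains_max[of V f] by blast
  have cV: "card (V - {m}) = k" using Suc.hyps(2) m(1) Suc.prems(1) by simp
  have "2 * sum f (V - {m}) \<le> k * (k - 1)"
    using Suc.hyps(1)[of "V - {m}"] gapfree_delete_max[of V f m, OF Suc.prems(2) m(2)] Suc.prems(1)
    unfolding cV by blast
  moreover have "f m < Suc k"
    using gapfree_less_card[of V f, OF Suc.prems m(1)] Suc.hyps(2) by simp
  moreover have "sum f V = f m + sum f (V - {m})"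
    using sum.remove[of V m f] Suc.prems(1) m(1) by simp
  ultimately have "2 * sum f V \<le> 2 * k + k * (k - 1)" by simp
  also have "\<dots> = Suc k * k" by (cases k) simp_all
  finally show ?case using Suc.hyps(2)[symmetric] by simp
qed

text \<open>
  If the bound is attained, then the largest value must be \<open>card V - 1\<close>, as the remaining points
  already satisfy the bound for \<open>card V - 1\<close> points. Then \<open>f\<close> takes \<open>card V\<close> values, one for each
  point.
\<close>
lemma gapfree_sum_eq:
  fixes f :: "'a \<Rightarrow> nat"
  assumes "finite V" and gf: "\<And>x. x \<in> V \<Longrightarrow> f x > 0 \<Longrightarrow> \<exists>y\<in>V. f x = Suc (f y)"
    and eq: "2 * sum f V = card V * (card V - 1)"
  shows "bij_betw f V {..<card V}"
proof (cases "V = {}")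
  case True
  then show ?thesis by (simp add: bij_betw_def)
next
  case False
  with assms(1) obtain m where m: "m \<in> V" "\<And>y. y \<in> V \<Longrightarrow> f y \<le> f m"
    using finite_attains_max[of V f] by blast
  define k where "k = card (V - {m})"
  have cV: "card V = Suc k" using assms(1) m(1) k_def card_Suc_Diff1 by metis
  have "2 * sum f (V - {m}) \<le> k * (k - 1)"
    using gapfree_sum_le[of "V - {m}" f] gapfree_delete_max[of V f m, OF gf m(2)] assms(1)
    unfolding k_def by blast
  moreover have "sum f V = f m + sum f (V - {m})"
    using sum.remove[of V m f] assms(1) m(1) by simp
  moreover have "Suc k * k = 2 * k + k * (k - 1)" by (cases k) simp_all
  ultimately have "k \<le> f m" using eq unfolding cV by simp
  then have "{..<card V} \<subseteq> f ` V"
    using gapfree_atMost_subset[of V f, OF gf m(1)] cV by auto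
  moreover have "f ` V \<subseteq> {..<card V}"
    using gapfree_less_card[of V f, OF assms(1) gf] by auto
  ultimately have img: "f ` V = {..<card V}" by blast
  then show ?thesis using eq_card_imp_inj_on[of V f] assms(1) by (simp add: bij_betw_def)
qed

section \<open>Distances in digraphs\<close>

context fin_digraph
begin

lemma path_dist_le_length:
  assumes "awalk u p v"
  shows "path_dist G u v \<le> length p"
proof -
  have "awalk_cost (\<lambda>_. 1) p = real (length p)" by (induct p) simp_all
  then have "ereal (real (path_dist G u v)) \<le> ereal (real (length p))"
    using min_cost_le_walk_cost[OF assms, of "\<lambda>_. 1"] real_path_dist_eq_mu assms
      reachable_awalk by metis
  then show ?thesis by simp
qed

lemma path_dist_attained:
  assumes "u \<rightarrow>\<^sup>* v"
  obtains p where "awalk u p v" and "length p = path_dist G u v"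
proof -
  have cost: "awalk_cost (\<lambda>_. 1) p = real (length p)" for p :: "'b list" by (induct p) simp_all
  obtain p where p: "apath u p v" "\<mu> (\<lambda>_. 1) u v = awalk_cost (\<lambda>_. 1) p"
    using min_cost_awalk[OF assms, of "\<lambda>_. 1"] by auto
  then have "length p = path_dist G u v"
    using real_path_dist_eq_mu[OF assms] by (simp add: cost)
  with p(1) that show thesis by (auto simp: apath_def)
qed

lemma path_dist_dominates_le:
  assumes "u \<rightarrow>\<^sup>* v" and "v \<rightarrow> w"
  shows "path_dist G u w \<le> Suc (path_dist G u v)"
proof -
  obtain p where p: "awalk u p v" "length p = path_dist G u v"
    using path_dist_attained[OF assms(1)] .
  obtain a where a: "a \<in> arcs G" "tail G a = v" "head G a = w"
    using assms(2) by (rule reachableE)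
  then have "awalk v [a] w" by (auto simp: awalk_simps)
  with p(1) have "awalk u (p @ [a]) w" by (rule awalk_appendI)
  then have "path_dist G u w \<le> length (p @ [a])" by (rule path_dist_le_length)
  then show ?thesis using p(2) by simp
qed

lemma path_dist_self:
  assumes "u \<in> verts G"
  shows "path_dist G u u = 0"
  using path_dist_le_length[of u "[]" u] assms by (simp add: awalk_Nil_iff)

lemma path_dist_eq_0_iff:
  assumes "u \<rightarrow>\<^sup>* v"
  shows "path_dist G u v = 0 \<longleftrightarrow> u = v"
proof
  assume "path_dist G u v = 0"
  then obtain p where "awalk u p v" "p = []" using path_dist_attained[OF assms] by auto
  then show "u = v" by (simp add: awalk_Nil_iff)
next
  assume "u = v"
  then show "path_dist G u v = 0" using path_dist_self reachable_in_verts(1)[OF assms] by simp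
qed

text \<open>
  The in-neighbour is the penultimate vertex of a shortest walk.
\<close>
lemma path_dist_predecessor:
  assumes "u \<rightarrow>\<^sup>* v" and "path_dist G u v > 0"
  obtains w where "u \<rightarrow>\<^sup>* w" and "w \<rightarrow> v" and "path_dist G u v = Suc (path_dist G u w)"
proof -
  obtain p where p: "awalk u p v" "length p = path_dist G u v"
    using path_dist_attained[OF assms(1)] .
  with assms(2) obtain q a where qa: "p = q @ [a]" by (cases p rule: rev_cases) auto
  define w where "w = tail G a"
  have q: "awalk u q w" and a: "a \<in> arcs G" "head G a = v"
    using p(1) by (auto simp: qa w_def awalk_simps)
  have uw: "u \<rightarrow>\<^sup>* w" using q by (auto simp: reachable_awalk)
  have wv: "w \<rightarrow> v" using a by (auto simp: w_def arcs_ends_conv)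
  have "path_dist G u v = Suc (path_dist G u w)"
    using path_dist_le_length[OF q] path_dist_dominates_le[OF uw wv] p(2) by (simp add: qa)
  with uw wv that show thesis by blast
qed

end

lemma vwalk_arcs_subset:
  assumes "\<And>i. Suc i < length p \<Longrightarrow> (p ! i, p ! Suc i) \<in> E"
  shows "set (vwalk_arcs p) \<subseteq> E"
  using assms
proof (induct p rule: vwalk_arcs.induct)
  case (3 x y xs)
  from 3(2)[of "Suc i" for i] have "set (vwalk_arcs (y # xs)) \<subseteq> E" by (intro 3(1)) simp
  with 3(2)[of 0] show ?case by simp
qed simp_all

lemma (in digraph) path_dist_eq_1_iff:
  assumes "u \<rightarrow>\<^sup>* v"
  shows "path_dist G u v = 1 \<longleftrightarrow> u \<rightarrow> v"
proof
  assume d: "path_dist G u v = 1"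
  then obtain w where w: "u \<rightarrow>\<^sup>* w" "w \<rightarrow> v" "path_dist G u v = Suc (path_dist G u w)"
    using path_dist_predecessor[OF assms] by auto
  then have "u = w" using path_dist_eq_0_iff[OF w(1)] d by simp
  with w(2) show "u \<rightarrow> v" by simp
next
  assume uv: "u \<rightarrow> v"
  then have "u \<noteq> v" using adj_not_same by blast
  then have "path_dist G u v \<noteq> 0" using path_dist_eq_0_iff[OF assms] by simp
  moreover have "u \<in> verts G" using assms by (rule reachable_in_verts(1))
  then have "path_dist G u v \<le> Suc 0"
    using path_dist_dominates_le[OF _ uv, of u] path_dist_self by simp
  ultimately show "path_dist G u v = 1" by simp
qed

text \<open>
  As there are no parallel arcs, the out-degree counts out-neighbours; as there are no loops, these
  are distinct from \<open>w\<close>.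
\<close>
lemma (in digraph) out_degree_eq_iff:
  assumes "w \<in> verts G"
  shows "out_degree G w = card (verts G) - 1 \<longleftrightarrow> (\<forall>x\<in>verts G - {w}. w \<rightarrow> x)"
proof -
  let ?N = "head G ` out_arcs G w"
  have "inj_on (head G) (out_arcs G w)"
    by (rule inj_onI) (auto simp: arc_to_ends_def intro: no_multi_arcs)
  then have deg: "out_degree G w = card ?N" by (simp add: out_degree_def card_image)
  have sub: "?N \<subseteq> verts G - {w}" using no_loops by fastforce
  have N: "x \<in> ?N \<longleftrightarrow> w \<rightarrow> x" for x by (auto simp: arcs_ends_conv)
  have card: "card (verts G - {w}) = card (verts G) - 1" using assms by simp
  have "out_degree G w = card (verts G) - 1 \<longleftrightarrow> ?N = verts G - {w}"
    using card_subset_eq[OF _ sub] unfolding deg card[symmetric] by auto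
  also have "\<dots> \<longleftrightarrow> (\<forall>x\<in>verts G - {w}. w \<rightarrow> x)" using sub N by blast
  finally show ?thesis .
qed

section \<open>Total distances in strong digraphs\<close>

locale strong_digraph = digraph +
  assumes strong: "strongly_connected G"
begin

lemma reach: "u \<in> verts G \<Longrightarrow> v \<in> verts G \<Longrightarrow> u \<rightarrow>\<^sup>* v"
  using strong by auto

lemma path_dist_gapfree:
  assumes "u \<in> verts G" and "v \<in> verts G" and "path_dist G u v > 0"
  shows "\<exists>w\<in>verts G. path_dist G u v = Suc (path_dist G u w)"
  using path_dist_predecessor[OF reach[OF assms(1,2)] assms(3)] reachable_in_verts(2) by metis

lemma total_dist_le:
  assumes "u \<in> verts G"
  shows "2 * total_dist G u \<le> card (verts G) * (card (verts G) - 1)"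
  unfolding total_dist_def
  by (rule gapfree_sum_le) (use path_dist_gapfree assms in auto)

lemma path_dist_ge_1:
  assumes "u \<in> verts G" and "v \<in> verts G - {u}"
  shows "1 \<le> path_dist G u v"
  using path_dist_eq_0_iff[OF reach, of u v] assms by auto

lemma total_dist_delete: "u \<in> verts G \<Longrightarrow> total_dist G u = (\<Sum>v\<in>verts G - {u}. path_dist G u v)"
  unfolding total_dist_def using sum.remove[of "verts G" u "path_dist G u"] path_dist_self[of u] by simp

lemma total_dist_ge:
  assumes "u \<in> verts G"
  shows "card (verts G) - 1 \<le> total_dist G u"
  using sum_mono[of "verts G - {u}" "\<lambda>_. 1" "path_dist G u"] path_dist_ge_1[OF assms] assms
  by (simp add: total_dist_delete)

lemma total_dist_eq_iff:
  assumes "u \<in> verts G"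
  shows "total_dist G u = card (verts G) - 1 \<longleftrightarrow> (\<forall>x\<in>verts G - {u}. u \<rightarrow> x)"
proof -
  let ?V = "verts G - {u}"
  have one: "(\<Sum>v\<in>?V. 1) = card (verts G) - 1" using assms by simp
  have "total_dist G u = card (verts G) - 1 \<longleftrightarrow> (\<forall>x\<in>?V. path_dist G u x = 1)"
  proof
    assume "total_dist G u = card (verts G) - 1"
    then have "(\<Sum>v\<in>?V. 1) = (\<Sum>v\<in>?V. path_dist G u v)"
      using assms one by (simp add: total_dist_delete)
    then show "\<forall>x\<in>?V. path_dist G u x = 1"
      using sum_mono_inv[of "\<lambda>_. 1" ?V "path_dist G u"] path_dist_ge_1[OF assms] by simp
  next
    assume "\<forall>x\<in>?V. path_dist G u x = 1"
    then show "total_dist G u = card (verts G) - 1"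
      using assms one by (simp add: total_dist_delete)
  qed
  also have "\<dots> \<longleftrightarrow> (\<forall>x\<in>?V. u \<rightarrow> x)"
    using path_dist_eq_1_iff[OF reach] assms by auto
  finally show ?thesis .
qed

section \<open>Extremal vertices and dipaths without shortcuts\<close>

text \<open>
  When the total distance from \<open>u\<close> is as large as possible, there is exactly one vertex at each
  distance from \<open>u\<close>. The in-neighbour that precedes the vertex at distance \<open>k + 1\<close> on a shortest
  dipath must then be the vertex at distance \<open>k\<close>, and a shortcut would make some distance too
  small.
\<close>
lemma hamiltonian_dipath_of_extremal:
  assumes u: "u \<in> verts G" and eq: "2 * total_dist G u = card (verts G) * (card (verts G) - 1)"
  obtains v :: "nat \<Rightarrow> 'a"
  where "hamiltonian_dipath (map v [1..<card (verts G) + 1]) G"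
    and "\<And>i j. 1 \<le> i \<Longrightarrow> i + 1 < j \<Longrightarrow> j \<le> card (verts G) \<Longrightarrow> \<not> v i \<rightarrow> v j"
proof -
  define f where "f = path_dist G u"
  define n where "n = card (verts G)"
  have "bij_betw f (verts G) {..<card (verts G)}"
    unfolding f_def
    by (rule gapfree_sum_eq) (use path_dist_gapfree[OF u] eq in \<open>auto simp: total_dist_def\<close>)
  then have bij: "bij_betw f (verts G) {..<n}" by (simp add: n_def)
  \<comment> \<open>The list starts at index 1, so position \<open>i\<close> holds the vertex at distance \<open>i - 1\<close>.\<close>
  define v where "v i = inv_into (verts G) f (i - 1)" for i
  have vV: "v i \<in> verts G" and fv: "f (v i) = i - 1" if "1 \<le> i" "i \<le> n" for i
  proof -
    have "i - 1 \<in> f ` verts G" using bij that by (auto simp: bij_betw_def)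
    then show "v i \<in> verts G" "f (v i) = i - 1"
      unfolding v_def by (rule inv_into_into, rule f_inv_into_f)
  qed
  have surj: "x = v (Suc (f x))" if "x \<in> verts G" for x
    using bij that by (simp add: v_def bij_betw_def)
  have f_less: "f x < n" if "x \<in> verts G" for x using bij that by (auto simp: bij_betw_def)
  have img: "v ` {1..<n + 1} = verts G"
  proof
    show "v ` {1..<n + 1} \<subseteq> verts G" using vV by auto
    show "verts G \<subseteq> v ` {1..<n + 1}"
    proof
      fix x assume "x \<in> verts G"
      with surj[of x] f_less[of x] show "x \<in> v ` {1..<n + 1}"
        by (intro image_eqI[of _ _ "Suc (f x)"]) auto
    qed
  qed
  have inj: "inj_on v {1..<n + 1}"
  proof (rule inj_onI)
    fix i j assume "i \<in> {1..<n + 1}" "j \<in> {1..<n + 1}" "v i = v j"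
    then show "i = j" using fv[of i] fv[of j] by auto
  qed
  have arc: "v i \<rightarrow> v (Suc i)" if i: "1 \<le> i" "Suc i \<le> n" for i
  proof -
    have "path_dist G u (v (Suc i)) = i" using fv[of "Suc i"] i by (simp add: f_def)
    then obtain w where w: "u \<rightarrow>\<^sup>* w" "w \<rightarrow> v (Suc i)" "i = Suc (f w)"
      using path_dist_predecessor[OF reach[OF u vV[of "Suc i"]]] i by (auto simp: f_def)
    then have "w = v i" using surj[of w] reachable_in_verts(2) by blast
    with w(2) show ?thesis by simp
  qed
  have noshort: "\<not> v i \<rightarrow> v j" if "1 \<le> i" "i + 1 < j" "j \<le> n" for i j
    using path_dist_dominates_le[OF reach[OF u vV[of i]], of "v j"] fv[of i] fv[of j] that
    by (auto simp: f_def)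
  have "n \<noteq> 0" using u by (auto simp: n_def)
  then have "hamiltonian_dipath (map v [1..<n + 1]) G"
    unfolding hamiltonian_dipath_def vpath_def vwalk_def
  proof (intro conjI)
    show "set (vwalk_arcs (map v [1..<n + 1])) \<subseteq> arcs_ends G"
      by (rule vwalk_arcs_subset) (use arc in \<open>auto simp: nth_append simp del: upt_Suc\<close>)
  qed (use img inj in \<open>auto simp: distinct_map simp del: upt_Suc\<close>)
  with noshort that show thesis by (simp add: n_def)
qed

text \<open>
  A walk advances by at most one position per arc along a list without shortcuts. Hence the vertex
  at position \<open>i\<close> is at distance at least \<open>i - 1\<close> from the first one. The total distance is then at
  least \<open>n (n - 1) / 2\<close>, which is also its upper bound.
\<close>
lemma total_dist_of_no_shortcut:
  fixes v :: "nat \<Rightarrow> 'a"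
  assumes bij: "bij_betw v {1..card (verts G)} (verts G)" and ne: "verts G \<noteq> {}"
    and noshort: "\<And>i j. 1 \<le> i \<Longrightarrow> i + 1 < j \<Longrightarrow> j \<le> card (verts G) \<Longrightarrow> \<not> v i \<rightarrow> v j"
  shows "2 * total_dist G (v 1) = card (verts G) * (card (verts G) - 1)"
proof -
  define n where "n = card (verts G)"
  have n: "1 \<le> n" using ne by (simp add: n_def Suc_leI card_gt_0_iff)
  have vV: "v i \<in> verts G" if "1 \<le> i" "i \<le> n" for i
    using bij that by (auto simp: bij_betw_def n_def)
  have far: "i - 1 \<le> path_dist G (v 1) (v i)" if "1 \<le> i" "i \<le> n" for i
    using that
  proof (induction "path_dist G (v 1) (v i)" arbitrary: i)
    case 0
    have "v 1 = v i"
      using path_dist_eq_0_iff[OF reach[OF vV[of 1] vV[of i]]] 0(1)[symmetric] 0(2,3) n by simp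
    moreover have "inj_on v {1..n}" using bij by (simp add: bij_betw_def n_def)
    ultimately have "1 = i" using inj_onD[of v "{1..n}" 1 i] 0(2,3) n by simp
    then show ?case by simp
  next
    case (Suc k)
    have d: "path_dist G (v 1) (v i) = Suc k" using Suc.hyps(2) by (rule sym)
    then have pos: "path_dist G (v 1) (v i) > 0" by linarith
    have "v 1 \<rightarrow>\<^sup>* v i" using reach[OF vV vV] Suc.prems n by blast
    then obtain w where w: "v 1 \<rightarrow>\<^sup>* w" "w \<rightarrow> v i" "Suc k = Suc (path_dist G (v 1) w)"
      using path_dist_predecessor[OF _ pos] unfolding d by blast
    then have "w \<in> v ` {1..n}" using bij reachable_in_verts(2) by (auto simp: bij_betw_def n_def)
    then obtain j where j: "w = v j" "1 \<le> j" "j \<le> n" by auto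
    then have "j - 1 \<le> k" using Suc.hyps(1)[of j] w(3) by simp
    moreover have "\<not> j + 1 < i" using noshort[of j i] w(2) j Suc.prems by (auto simp: n_def)
    ultimately have "i - 1 \<le> Suc k" using j(2) by linarith
    then show ?case unfolding d .
  qed
  have gauss: "2 * (\<Sum>i=1..m. i - 1) = m * (m - 1)" for m :: nat
  proof (induction m)
    case (Suc m)
    then show ?case by (cases m) (simp_all add: algebra_simps)
  qed simp
  have "(\<Sum>i=1..n. i - 1) \<le> (\<Sum>i=1..n. path_dist G (v 1) (v i))"
    by (rule sum_mono) (use far in auto)
  also have "\<dots> = total_dist G (v 1)"
    unfolding total_dist_def using bij by (intro sum.reindex_bij_betw) (simp add: n_def)
  finally have "n * (n - 1) \<le> 2 * total_dist G (v 1)" using gauss[of n] by linarith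
  with total_dist_le[OF vV[of 1]] n show ?thesis by (simp add: n_def)
qed

section \<open>Remoteness and proximity\<close>

lemma average_dist_le:
  assumes "u \<in> verts G" and "card (verts G) \<ge> 2"
  shows "average_dist G u \<le> card (verts G) / 2"
    and "average_dist G u = card (verts G) / 2 \<longleftrightarrow>
      2 * total_dist G u = card (verts G) * (card (verts G) - 1)"
proof -
  define n where "n = card (verts G)"
  have n: "real n - 1 > 0" "real (n - 1) = real n - 1" using assms(2) by (simp_all add: n_def)
  have "real (2 * total_dist G u) \<le> real (n * (n - 1))"
    using total_dist_le[OF assms(1)] unfolding n_def by (rule of_nat_mono)
  then show "average_dist G u \<le> card (verts G) / 2"
    using n by (simp add: average_dist_def n_def[symmetric] field_simps)
  have "average_dist G u = card (verts G) / 2 \<longleftrightarrow> real (2 * total_dist G u) = real (n * (n - 1))"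
    using n by (simp add: average_dist_def n_def[symmetric] field_simps)
  then show "average_dist G u = card (verts G) / 2 \<longleftrightarrow>
      2 * total_dist G u = card (verts G) * (card (verts G) - 1)"
    unfolding of_nat_eq_iff n_def .
qed

lemma average_dist_ge:
  assumes "u \<in> verts G" and "card (verts G) \<ge> 2"
  shows "1 \<le> average_dist G u"
    and "average_dist G u = 1 \<longleftrightarrow> out_degree G u = card (verts G) - 1"
proof -
  define n where "n = card (verts G)"
  have n: "real n - 1 > 0" "real (n - 1) = real n - 1" using assms(2) by (simp_all add: n_def)
  have "real (n - 1) \<le> real (total_dist G u)"
    using total_dist_ge[OF assms(1)] unfolding n_def by (rule of_nat_mono)
  then show "1 \<le> average_dist G u"
    using n by (simp add: average_dist_def n_def[symmetric] field_simps)
  have "average_dist G u = 1 \<longleftrightarrow> real (total_dist G u) = real (n - 1)"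
    using n by (auto simp: average_dist_def n_def[symmetric] field_simps)
  then show "average_dist G u = 1 \<longleftrightarrow> out_degree G u = card (verts G) - 1"
    unfolding of_nat_eq_iff n_def total_dist_eq_iff[OF assms(1)] out_degree_eq_iff[OF assms(1)] .
qed

lemma remoteness_le:
  assumes "card (verts G) \<ge> 2"
  shows "remoteness G \<le> card (verts G) / 2"
    and "remoteness G = card (verts G) / 2 \<longleftrightarrow>
      (\<exists>u\<in>verts G. 2 * total_dist G u = card (verts G) * (card (verts G) - 1))"
proof -
  let ?A = "average_dist G ` verts G"
  have rem: "remoteness G = Max ?A"
    unfolding remoteness_def by (rule arg_cong[of _ _ Max]) auto
  have A: "finite ?A" "?A \<noteq> {}" using assms by auto
  show le: "remoteness G \<le> card (verts G) / 2"
    unfolding rem by (rule Max.boundedI[OF A]) (use average_dist_le(1) assms in blast)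
  have "remoteness G = card (verts G) / 2 \<longleftrightarrow> (\<exists>u\<in>verts G. average_dist G u = card (verts G) / 2)"
  proof
    assume "remoteness G = card (verts G) / 2"
    then show "\<exists>u\<in>verts G. average_dist G u = card (verts G) / 2"
      using Max_in[OF A] unfolding rem by force
  next
    assume "\<exists>u\<in>verts G. average_dist G u = card (verts G) / 2"
    then have "card (verts G) / 2 \<in> ?A" by force
    then show "remoteness G = card (verts G) / 2"
      using Max_ge[OF A(1)] le unfolding rem by (meson order_antisym)
  qed
  then show "remoteness G = card (verts G) / 2 \<longleftrightarrow>
      (\<exists>u\<in>verts G. 2 * total_dist G u = card (verts G) * (card (verts G) - 1))"
    using average_dist_le(2) assms by blast
qed

lemma proximity_ge:
  assumes "card (verts G) \<ge> 2"
  shows "1 \<le> proximity G"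
    and "proximity G = 1 \<longleftrightarrow> (\<exists>u\<in>verts G. out_degree G u = card (verts G) - 1)"
proof -
  let ?A = "average_dist G ` verts G"
  have prox: "proximity G = Min ?A"
    unfolding proximity_def by (rule arg_cong[of _ _ Min]) auto
  have A: "finite ?A" "?A \<noteq> {}" using assms by auto
  show le: "1 \<le> proximity G"
    unfolding prox by (rule Min.boundedI[OF A]) (use average_dist_ge(1) assms in blast)
  have "proximity G = 1 \<longleftrightarrow> (\<exists>u\<in>verts G. average_dist G u = 1)"
  proof
    assume "proximity G = 1"
    then show "\<exists>u\<in>verts G. average_dist G u = 1"
      using Min_in[OF A] unfolding prox by force
  next
    assume "\<exists>u\<in>verts G. average_dist G u = 1"
    then have "1 \<in> ?A" by force
    then show "proximity G = 1"
      using Min_le[OF A(1)] le unfolding prox by (meson order_antisym)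
  qed
  then show "proximity G = 1 \<longleftrightarrow> (\<exists>u\<in>verts G. out_degree G u = card (verts G) - 1)"
    using average_dist_ge(2) assms by blast
qed

end

theorem theorem2p2:
  fixes D :: "('a, 'b) pre_digraph" and n :: nat
  assumes "digraph D"
    and "strongly_connected D"
    and "card (verts D) = n"
    and "n \<ge> 2"
  shows "remoteness D - proximity D \<le> real n / 2 - 1 \<and>
    (remoteness D - proximity D = real n / 2 - 1 \<longleftrightarrow>
      (\<exists>v :: nat \<Rightarrow> 'a.
        hamiltonian_dipath (map v [1..<n + 1]) D \<and>
        {(v i, v j) | i j. 2 \<le> i + 1 \<and> i + 1 < j \<and> j \<le> n} \<subseteq> parcs (complement_digraph D) \<and>
        (out_degree D (v (n - 1)) = n - 1 \<or> out_degree D (v n) = n - 1)))"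
    (is "_ \<and> (_ \<longleftrightarrow> (\<exists>v. ?ham v \<and> ?short v \<and> ?deg v))")
proof -
  interpret digraph D by fact
  interpret strong_digraph D by unfold_locales fact
  have n2: "card (verts D) \<ge> 2" using assms(3,4) by simp
  note rem = remoteness_le[OF n2, unfolded assms(3)]
  note prox = proximity_ge[OF n2, unfolded assms(3)]
  have "remoteness D - proximity D = real n / 2 - 1 \<longleftrightarrow>
      remoteness D = real n / 2 \<and> proximity D = 1"
    using rem(1) prox(1) by linarith
  also have "\<dots> \<longleftrightarrow> (\<exists>v. ?ham v \<and> ?short v \<and> ?deg v)"
  proof
    assume "remoteness D = real n / 2 \<and> proximity D = 1"
    then obtain u w where u: "u \<in> verts D" "2 * total_dist D u = n * (n - 1)"
      and w: "w \<in> verts D" "out_degree D w = n - 1"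
      using rem(2) prox(2) by blast
    obtain v where ham: "?ham v"
      and noshort: "\<And>i j. 1 \<le> i \<Longrightarrow> i + 1 < j \<Longrightarrow> j \<le> n \<Longrightarrow> \<not> v i \<rightarrow>\<^bsub>D\<^esub> v j"
      using hamiltonian_dipath_of_extremal[OF u(1)] u(2) unfolding assms(3) by metis
    have img: "v ` {1..<n + 1} = verts D" and inj: "inj_on v {1..<n + 1}"
      using ham by (auto simp: hamiltonian_dipath_def vpath_def distinct_map simp del: upt_Suc)
    have "?short v"
    proof clarify
      fix i j assume ij: "2 \<le> i + 1" "i + 1 < j" "j \<le> n"
      then have "v i \<noteq> v j" using inj_onD[OF inj, of i j] by auto
      moreover have "v i \<in> verts D" "v j \<in> verts D" using ij img by auto
      ultimately show "(v i, v j) \<in> parcs (complement_digraph D)"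
        using noshort[of i j] ij by (simp add: complement_digraph_def)
    qed
    moreover have "?deg v"
    proof -
      obtain k where k: "w = v k" "1 \<le> k" "k \<le> n" using w(1) img by force
      \<comment> \<open>Otherwise the arc from \<open>w\<close> to the last vertex would be a shortcut.\<close>
      have "\<not> k + 1 < n"
      proof
        assume kn: "k + 1 < n"
        then have "v n \<noteq> v k" "v n \<in> verts D" using inj_onD[OF inj, of n k] k img by auto
        then have "v k \<rightarrow>\<^bsub>D\<^esub> v n" using w k(1) out_degree_eq_iff[OF w(1)] assms(3) by auto
        then show False using noshort[of k n] kn k(2) by simp
      qed
      then have "k = n - 1 \<or> k = n" using k(3) by linarith
      then show ?thesis using w(2) k(1) by auto
    qed
    ultimately show "\<exists>v. ?ham v \<and> ?short v \<and> ?deg v" using ham by blast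
  next
    assume "\<exists>v. ?ham v \<and> ?short v \<and> ?deg v"
    then obtain v where v: "?ham v" "?short v" "?deg v" by blast
    then have img: "v ` {1..<n + 1} = verts D" and inj: "inj_on v {1..<n + 1}"
      by (auto simp: hamiltonian_dipath_def vpath_def distinct_map simp del: upt_Suc)
    have vV: "v i \<in> verts D" if "1 \<le> i" "i \<le> n" for i using img that by auto
    have "bij_betw v {1..card (verts D)} (verts D)"
      using img inj by (simp add: bij_betw_def assms(3) atLeastLessThanSuc_atLeastAtMost)
    moreover have "\<not> v i \<rightarrow>\<^bsub>D\<^esub> v j" if "1 \<le> i" "i + 1 < j" "j \<le> card (verts D)" for i j
    proof -
      have "(v i, v j) \<in> parcs (complement_digraph D)" using that v(2) assms(3) by auto
      then show ?thesis by (simp add: complement_digraph_def)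
    qed
    moreover have "verts D \<noteq> {}" using n2 by auto
    ultimately have "2 * total_dist D (v 1) = n * (n - 1)"
      using total_dist_of_no_shortcut[of v] unfolding assms(3) by blast
    then have "remoteness D = real n / 2" using rem(2) vV[of 1] assms(4) by auto
    moreover have "proximity D = 1"
      using prox(2) v(3) vV[of n] vV[of "n - 1"] assms(4) by auto
    ultimately show "remoteness D = real n / 2 \<and> proximity D = 1" by simp
  qed
  finally have "remoteness D - proximity D = real n / 2 - 1 \<longleftrightarrow> (\<exists>v. ?ham v \<and> ?short v \<and> ?deg v)" .
  moreover have "remoteness D - proximity D \<le> real n / 2 - 1" using rem(1) prox(1) by linarith
  ultimately show ?thesis by blast
qed

end
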